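(* Suppose $(y^*,z^* )\in\mathbb{R}_+\times\mathbb{R}^n_+$ satisfies $z^*\in\mathrm{conv}(\mathcal{P})$. Let $$LP^*:=\min\Big\{\sum_{j\in[n]}\alpha_jz^*_j-\beta:\ (\alpha,\beta)\in\mathcal{G}\Big\}.$$ Then $(y^*,z^* )\in\mathrm{conv}(\mathcal{Q})$ if and only if $y^*+LP^*\geq 0$. Also, if $y^*+LP^*<0$ and $(\alpha^*,\beta^* )$ is an optimal solution to this minimization problem, then $y+\sum_{j\in[n]}\alpha^*_jz_j\geq\beta^*$ is a valid inequality for $\mathrm{conv}(\mathcal{Q})$ which is violated by $(y^*,z^* )$.
   Context: Let $n\ge 1$ be an integer and $[n]=\{1,\dots,n\}$. Let $h_1\geq h_2\geq\cdots\geq h_n\geq 0$ be reals, let $a\in\mathbb{R}^n$ with $a_j\ge 0$ for all $j$, and let $p\ge 0$ be real, with $a_j\leq p$ for all $j\in[n]$ and $\sum_{j\in[n]}a_j>p$. Define $$\mathcal{Q}:=\Big\{(y,z)\in\mathbb{R}_+\times\{0,1\}^n:\ \sum_{j\in[n]}a_jz_j\leq p,\ \ y+h_jz_j\geq h_j\ \ \forall j\in[n]\Big\},$$ $$\mathcal{P}:=\Big\{z\in\{0,1\}^n:\ \sum_{j\in[n]}a_jz_j\leq p\Big\},$$ where $\mathbb{R}_+$ denotes the nonnegative reals. Let $\nu:=\max\{k\in\{0,\dots,n\}:\sum_{j\leq k}a_j\leq p\}$ (so $\nu<n$). For $0\leq k\leq\nu$ let $$\mathcal{P}_k:=\Big\{z\in\{0,1\}^n:\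 \sum_{j>k}a_jz_j\leq p-\sum_{j\leq k}a_j\Big\}.$$ The coefficient polyhedron $\mathcal{G}$ is the set of all $(\alpha,\beta)\in\mathbb{R}^n\times\mathbb{R}$ such that $$\sum_{j\leq k}\alpha_j+\sum_{j>k}\alpha_jz^*_j+h_{k+1}\geq\beta\qquad\forall\, z^*\in\mathcal{P}_k,\ \forall\, 0\leq k\leq\nu.$$ *)

theory Defs
  imports "HOL-Analysis.Analysis"
begin

text \<open>
  Vectors indexed by \<open>[n] = {1, \<dots>, n}\<close> are elements of \<open>real ^ 'n\<close> with \<open>n = CARD('n)\<close>.
  As a finite type carries no order, the positions \<open>1, \<dots>, n\<close> are given by an enumeration
  \<open>\<iota> :: nat \<Rightarrow> 'n\<close> with \<open>bij_betw \<iota> {1..CARD('n)} UNIV\<close>; the \<open>j\<close>-th entry of \<open>v\<close> is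
  \<open>v $ \<iota> j\<close>. Values of \<open>\<iota>\<close> outside \<open>{1..CARD('n)}\<close> are never used.
\<close>

definition binary_vec :: "real ^ 'n \<Rightarrow> bool" where
  "binary_vec z \<longleftrightarrow> (\<forall>j. z $ j \<in> {0, 1})"

definition Q_set :: "real ^ 'n \<Rightarrow> real ^ 'n \<Rightarrow> real \<Rightarrow> (real \<times> (real ^ 'n)) set" where
  "Q_set h a p =
     {(y, z). y \<ge> 0 \<and> binary_vec z \<and> (\<Sum>j\<in>UNIV. a $ j * z $ j) \<le> p \<and>
              (\<forall>j. y + h $ j * z $ j \<ge> h $ j)}"

definition P_set :: "real ^ 'n \<Rightarrow> real \<Rightarrow> (real ^ 'n) set" where
  "P_set a p = {z. binary_vec z \<and> (\<Sum>j\<in>UNIV. a $ j * z $ j) \<le> p}"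

definition nu :: "(nat \<Rightarrow> 'n) \<Rightarrow> real ^ 'n \<Rightarrow> real \<Rightarrow> nat" where
  "nu \<iota> a p = Max {k \<in> {0..CARD('n)}. (\<Sum>j=1..k. a $ \<iota> j) \<le> p}"

definition Pk_set :: "(nat \<Rightarrow> 'n) \<Rightarrow> real ^ 'n \<Rightarrow> real \<Rightarrow> nat \<Rightarrow> (real ^ 'n) set" where
  "Pk_set \<iota> a p k =
     {z. binary_vec z \<and>
         (\<Sum>j=k+1..CARD('n). a $ \<iota> j * z $ \<iota> j) \<le> p - (\<Sum>j=1..k. a $ \<iota> j)}"

definition coeff_polyhedron ::
    "(nat \<Rightarrow> 'n) \<Rightarrow> real ^ 'n \<Rightarrow> real ^ 'n \<Rightarrow> real \<Rightarrow> ((real ^ 'n) \<times> real) set" where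
  "coeff_polyhedron \<iota> h a p =
     {(\<alpha>, \<beta>). \<forall>k\<in>{0..nu \<iota> a p}. \<forall>z\<in>Pk_set \<iota> a p k.
        (\<Sum>j=1..k. \<alpha> $ \<iota> j) + (\<Sum>j=k+1..CARD('n). \<alpha> $ \<iota> j * z $ \<iota> j) + h $ \<iota> (k + 1) \<ge> \<beta>}"

definition sep_obj :: "real ^ 'n \<Rightarrow> (real ^ 'n) \<times> real \<Rightarrow> real" where
  "sep_obj z = (\<lambda>(\<alpha>, \<beta>). (\<Sum>j\<in>UNIV. \<alpha> $ j * z $ j) - \<beta>)"

definition sep_optimal ::
    "(nat \<Rightarrow> 'n) \<Rightarrow> real ^ 'n \<Rightarrow> real ^ 'n \<Rightarrow> real \<Rightarrow> real ^ 'n \<Rightarrow> (real ^ 'n) \<times> real \<Rightarrow> bool" where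
  "sep_optimal \<iota> h a p z = is_arg_min (sep_obj z) (\<lambda>s. s \<in> coeff_polyhedron \<iota> h a p)"

text \<open>
  The least objective value; meaningful only if the minimum is attained, i.e. if some
  \<open>sep_optimal\<close> point exists.
\<close>

definition sep_LP ::
    "(nat \<Rightarrow> 'n) \<Rightarrow> real ^ 'n \<Rightarrow> real ^ 'n \<Rightarrow> real \<Rightarrow> real ^ 'n \<Rightarrow> real" where
  "sep_LP \<iota> h a p z = (LEAST v. v \<in> sep_obj z ` coeff_polyhedron \<iota> h a p)"

end

theory Submission
  imports Defs
begin

text \<open>
  The argument is linear programming duality, made explicit through a finite point set. Call
  \<open>(h\<^sub>k\<^sub>+\<^sub>1, z)\<close> a \<^emph>\<open>corner point\<close> if \<open>k \<le> \<nu>\<close>, \<open>z \<in> P\<close> and \<open>z\<^sub>1 = \<dots> = z\<^sub>k = 1\<close>, and let \<open>V\<close> be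
  the (finite) set of these points. Two facts link \<open>V\<close> to the given sets.

  \<^item> \<open>V \<subseteq> Q\<close>, and every \<open>(y, z) \<in> Q\<close> lies above the corner point \<open>(h\<^sub>k\<^sub>+\<^sub>1, z)\<close>, where \<open>k\<close> is the length
    of the longest prefix of ones of \<open>z\<close>: then \<open>z\<^sub>k\<^sub>+\<^sub>1 = 0\<close>, which forces \<open>y \<ge> h\<^sub>k\<^sub>+\<^sub>1\<close>. As \<open>Q\<close> is closed
    under increasing \<open>y\<close>, the hull of \<open>Q\<close> is the hull of \<open>V\<close> together with everything above it, and
    the projection of \<open>V\<close> to the \<open>z\<close>-space is \<open>P\<close>.

  \<^item> The coefficient polyhedron consists of the \<open>(\<alpha>, \<beta>)\<close> for which \<open>y + \<alpha> \<bullet> z \<ge> \<beta>\<close> holds on \<open>V\<close>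
    (\<open>mem_coeff_polyhedron_iff\<close>).

  Let \<open>\<phi>\<close> be the least \<open>y\<close> with \<open>(y, z\<^sup>*) \<in> conv V\<close>; it exists because \<open>conv V\<close> is compact and
  \<open>z\<^sup>* \<in> conv P\<close>. Then \<open>(y\<^sup>*, z\<^sup>*) \<in> conv Q\<close> iff \<open>y\<^sup>* \<ge> \<phi>\<close>, and every \<open>(\<alpha>, \<beta>)\<close> in the coefficient
  polyhedron satisfies \<open>\<alpha> \<bullet> z\<^sup>* - \<beta> \<ge> - \<phi>\<close>. Equality is attained: \<open>conv V\<close> is a polyhedron that is left
  at once when \<open>y\<close> is decreased from \<open>(\<phi>, z\<^sup>*)\<close>, so one of its finitely many defining
  inequalities is tight there and has a nonzero coefficient of the right sign at \<open>y\<close>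
  (\<open>polyhedron_blocking_inequality\<close>). Scaling that coefficient to \<open>1\<close> gives an optimal \<open>(\<alpha>, \<beta>)\<close>.
  Hence the minimum is \<open>- \<phi>\<close>.
\<close>

section \<open>Polyhedra\<close>

text \<open>
  Finiteness of the system of inequalities is essential: for a general closed convex set, all
  supporting hyperplanes at a boundary point may be parallel to the blocked direction \<open>d\<close>.
\<close>

lemma polyhedron_blocking_inequality:
  fixes S :: "'a::euclidean_space set"
  assumes "polyhedron S" and "x \<in> S" and blocked: "\<And>t. t > 0 \<Longrightarrow> x + t *\<^sub>R d \<notin> S"
  obtains c b where "\<And>s. s \<in> S \<Longrightarrow> c \<bullet> s \<le> b" and "c \<bullet> x = b" and "c \<bullet> d > 0"
proof -
  obtain F where F: "finite F" "S = \<Inter>F" "\<forall>H\<in>F. \<exists>c b. c \<noteq> 0 \<and> H = {x. c \<bullet> x \<le> b}"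
    using assms(1) by (auto simp: polyhedron_def)
  have "\<exists>H\<in>F. \<forall>e>0. \<exists>t\<in>{0<..e}. x + t *\<^sub>R d \<notin> H"
  proof (rule ccontr)
    assume "\<not> ?thesis"
    then have "\<forall>H\<in>F. \<exists>e>0. \<forall>t\<in>{0<..e}. x + t *\<^sub>R d \<in> H"
      by blast
    then obtain e where e: "\<And>H. H \<in> F \<Longrightarrow> e H > 0"
      "\<And>H t. H \<in> F \<Longrightarrow> t \<in> {0<..e H} \<Longrightarrow> x + t *\<^sub>R d \<in> H"
      by metis
    define m where "m = Min (insert 1 (e ` F))"
    have "m > 0" "\<And>H. H \<in> F \<Longrightarrow> m \<le> e H"
      using F(1) e(1) by (auto simp: m_def)
    then have "x + m *\<^sub>R d \<in> S"
      using e(2) F(2) by auto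
    then show False
      using blocked \<open>m > 0\<close> by blast
  qed
  then obtain H where H: "H \<in> F" and out: "\<And>e. e > 0 \<Longrightarrow> \<exists>t\<in>{0<..e}. x + t *\<^sub>R d \<notin> H"
    by blast
  obtain c b where cb: "H = {x. c \<bullet> x \<le> b}"
    using F(3) H by blast
  have le: "c \<bullet> s \<le> b" if "s \<in> S" for s
    using that F(2) H cb by auto
  have pos: "c \<bullet> d > 0"
  proof -
    obtain t where t: "t > 0" "x + t *\<^sub>R d \<notin> H"
      using out[of 1] by auto
    then have "t * (c \<bullet> d) > 0"
      using le[OF \<open>x \<in> S\<close>] cb by (simp add: inner_add_right)
    then show ?thesis
      using t(1) by (simp add: zero_less_mult_iff)
  qed
  have "c \<bullet> x = b"
  proof (rule ccontr)
    assume "c \<bullet> x \<noteq> b"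
    then have slack: "b - c \<bullet> x > 0"
      using le[OF \<open>x \<in> S\<close>] by simp
    then obtain t where t: "t \<le> (b - c \<bullet> x) / (c \<bullet> d)" "x + t *\<^sub>R d \<notin> H"
      using out[of "(b - c \<bullet> x) / (c \<bullet> d)"] pos by auto
    then have "t * (c \<bullet> d) \<le> b - c \<bullet> x"
      using pos by (simp add: pos_le_divide_eq)
    then show False
      using t(2) cb by (simp add: inner_add_right)
  qed
  then show thesis
    using le pos that by blast
qed

text \<open>At a lowest point of a polytope there is a non-vertical supporting hyperplane.\<close>

lemma polytope_lower_support:
  fixes V :: "(real \<times> 'a::euclidean_space) set"
  assumes "finite V" and "(y0, z0) \<in> convex hull V"
    and lowest: "\<And>y. (y, z0) \<in> convex hull V \<Longrightarrow> y0 \<le> y"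
  obtains \<alpha> where "\<And>y z. (y, z) \<in> V \<Longrightarrow> y0 + \<alpha> \<bullet> z0 \<le> y + \<alpha> \<bullet> z"
proof -
  have "polyhedron (convex hull V)"
    using assms(1) by (simp add: polytope_convex_hull finite_imp_compact polytope_imp_polyhedron)
  moreover have "(y0, z0) + t *\<^sub>R (- 1, 0) \<notin> convex hull V" if "t > 0" for t
    using lowest[of "y0 - t"] that by auto
  ultimately obtain c b where c: "\<And>s. s \<in> convex hull V \<Longrightarrow> c \<bullet> s \<le> b"
    "c \<bullet> (y0, z0) = b" "c \<bullet> (- 1, 0) > 0"
    using polyhedron_blocking_inequality[OF _ assms(2)] by metis
  define q where "q = - fst c"
  have "q > 0"
    using c(3) by (cases c) (simp add: q_def)
  show thesis
  proof (rule that)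
    fix y z assume "(y, z) \<in> V"
    then have "c \<bullet> (y, z) \<le> c \<bullet> (y0, z0)"
      using c(1,2) hull_inc[of "(y, z)" V] by auto
    then have "q * y0 - snd c \<bullet> z0 \<le> q * y - snd c \<bullet> z"
      by (cases c) (simp add: q_def)
    then have "(q * y0 - snd c \<bullet> z0) / q \<le> (q * y - snd c \<bullet> z) / q"
      using \<open>q > 0\<close> by (intro divide_right_mono) auto
    then show "y0 + (- (1 / q) *\<^sub>R snd c) \<bullet> z0 \<le> y + (- (1 / q) *\<^sub>R snd c) \<bullet> z"
      using \<open>q > 0\<close> by (simp add: diff_divide_distrib)
  qed
qed

lemma convex_hull_shift_up:
  fixes V :: "(real \<times> 'a::real_vector) set"
  assumes "(y0, z0) \<in> convex hull V" and "y0 \<le> y1"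
    and up: "\<And>y z t. (y, z) \<in> V \<Longrightarrow> t \<ge> 0 \<Longrightarrow> (y + t, z) \<in> Q"
  shows "(y1, z0) \<in> convex hull Q"
proof -
  let ?shift = "(+) (y1 - y0, 0)"
  have "(y1, z0) \<in> ?shift ` (convex hull V)"
    using assms(1) by (force simp: image_iff)
  also have "\<dots> = convex hull (?shift ` V)"
    by (simp add: convex_hull_translation)
  also have "\<dots> \<subseteq> convex hull Q"
    using up \<open>y0 \<le> y1\<close> by (intro hull_mono) (auto simp: add.commute)
  finally show ?thesis .
qed

lemma convex_hull_valid_inequality:
  fixes V :: "(real \<times> 'a::real_inner) set"
  assumes "\<And>y z. (y, z) \<in> V \<Longrightarrow> \<beta> \<le> y + \<alpha> \<bullet> z" and "(y, z) \<in> convex hull V"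
  shows "\<beta> \<le> y + \<alpha> \<bullet> z"
proof -
  have "convex hull V \<subseteq> {x. (1, \<alpha>) \<bullet> x \<ge> \<beta>}"
    using assms(1) by (intro hull_minimal convex_halfspace_ge) auto
  then show ?thesis
    using assms(2) by auto
qed

section \<open>Binary vectors and enumerations\<close>

lemma finite_binary_vec: "finite {z :: real ^ 'n::finite. binary_vec z}"
proof (rule finite_subset)
  show "{z :: real ^ 'n. binary_vec z} \<subseteq> vec_lambda ` (UNIV \<rightarrow>\<^sub>E {0, 1})"
  proof
    fix z :: "real ^ 'n" assume "z \<in> {z. binary_vec z}"
    then have "z = vec_lambda (($) z)" "($) z \<in> UNIV \<rightarrow>\<^sub>E {0, 1}"
      by (auto simp: binary_vec_def PiE_def)
    then show "z \<in> vec_lambda ` (UNIV \<rightarrow>\<^sub>E {0, 1})"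
      by blast
  qed
  show "finite (vec_lambda ` (UNIV \<rightarrow>\<^sub>E {0, 1 :: real}) :: (real ^ 'n) set)"
    by (intro finite_imageI finite_PiE) auto
qed

lemma sum_UNIV_split_enum:
  fixes \<iota> :: "nat \<Rightarrow> 'n::finite" and f :: "'n \<Rightarrow> real"
  assumes "bij_betw \<iota> {1..CARD('n)} UNIV" and "k \<le> CARD('n)"
  shows "(\<Sum>j\<in>UNIV. f j) = (\<Sum>j=1..k. f (\<iota> j)) + (\<Sum>j=k+1..CARD('n). f (\<iota> j))"
proof -
  have "(\<Sum>j\<in>UNIV. f j) = (\<Sum>j\<in>{1..CARD('n)}. f (\<iota> j))"
    using sum.reindex_bij_betw[OF assms(1), of f] by simp
  also have "{1..CARD('n)} = {1..k} \<union> {k+1..CARD('n)}"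
    using assms(2) by auto
  also have "(\<Sum>j\<in>\<dots>. f (\<iota> j)) = (\<Sum>j=1..k. f (\<iota> j)) + (\<Sum>j=k+1..CARD('n). f (\<iota> j))"
    by (intro sum.union_disjoint) auto
  finally show ?thesis .
qed

text \<open>Replacing the first \<open>k\<close> entries of a vector by \<open>1\<close>.\<close>

definition fill_prefix :: "(nat \<Rightarrow> 'n) \<Rightarrow> nat \<Rightarrow> real ^ 'n \<Rightarrow> real ^ 'n" where
  "fill_prefix \<iota> k z = (\<chi> i. if i \<in> \<iota> ` {1..k} then 1 else z $ i)"

lemma sum_fill_prefix:
  fixes \<iota> :: "nat \<Rightarrow> 'n::finite"
  assumes "bij_betw \<iota> {1..CARD('n)} UNIV" and "k \<le> CARD('n)"
  shows "(\<Sum>j\<in>UNIV. c $ j * fill_prefix \<iota> k z $ j) =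
    (\<Sum>j=1..k. c $ \<iota> j) + (\<Sum>j=k+1..CARD('n). c $ \<iota> j * z $ \<iota> j)"
proof -
  have "\<iota> j \<notin> \<iota> ` {1..k}" if "j \<in> {k+1..CARD('n)}" for j
  proof
    assume "\<iota> j \<in> \<iota> ` {1..k}"
    then obtain i where "i \<in> {1..k}" "\<iota> j = \<iota> i"
      by blast
    then show False
      using that assms(2) inj_onD[OF bij_betw_imp_inj_on[OF assms(1)], of j i] by simp
  qed
  then have "(\<Sum>j=k+1..CARD('n). c $ \<iota> j * fill_prefix \<iota> k z $ \<iota> j) =
      (\<Sum>j=k+1..CARD('n). c $ \<iota> j * z $ \<iota> j)"
    by (intro sum.cong) (auto simp: fill_prefix_def)
  moreover have "(\<Sum>j=1..k. c $ \<iota> j * fill_prefix \<iota> k z $ \<iota> j) = (\<Sum>j=1..k. c $ \<iota> j)"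
    by (intro sum.cong) (auto simp: fill_prefix_def)
  ultimately show ?thesis
    by (simp only: sum_UNIV_split_enum[OF assms])
qed

lemma sum_prefix_ones:
  fixes \<iota> :: "nat \<Rightarrow> 'n::finite" and c z :: "real ^ 'n"
  assumes "bij_betw \<iota> {1..CARD('n)} UNIV" and "k \<le> CARD('n)" and "\<forall>j\<in>{1..k}. z $ \<iota> j = 1"
  shows "(\<Sum>j\<in>UNIV. c $ j * z $ j) =
    (\<Sum>j=1..k. c $ \<iota> j) + (\<Sum>j=k+1..CARD('n). c $ \<iota> j * z $ \<iota> j)"
  using assms(3) by (simp add: sum_UNIV_split_enum[OF assms(1,2)])

lemma nu_less_card:
  fixes \<iota> :: "nat \<Rightarrow> 'n::finite"
  assumes bij: "bij_betw \<iota> {1..CARD('n)} UNIV" and "p \<ge> 0" and big: "(\<Sum>j\<in>UNIV. a $ j) > p"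
  shows "nu \<iota> a p < CARD('n)"
proof -
  let ?K = "{k \<in> {0..CARD('n)}. (\<Sum>j=1..k. a $ \<iota> j) \<le> p}"
  have "0 \<in> ?K"
    using \<open>p \<ge> 0\<close> by simp
  then have "nu \<iota> a p \<in> ?K"
    unfolding nu_def by (intro Max_in) (simp, blast)
  moreover have "(\<Sum>j=1..CARD('n). a $ \<iota> j) > p"
    using big sum_UNIV_split_enum[OF bij order_refl, of "($) a"] by simp
  ultimately show ?thesis
    by (cases "nu \<iota> a p = CARD('n)") auto
qed

section \<open>Corner points\<close>

text \<open>
  The lowest points of \<open>Q\<close> above the binary vectors of \<open>P\<close>, together with some redundant higher
  ones, since \<open>k\<close> need not be the full length of the prefix of ones.
\<close>

definition corner_points ::
    "(nat \<Rightarrow> 'n::finite) \<Rightarrow> real ^ 'n \<Rightarrow> real ^ 'n \<Rightarrow> real \<Rightarrow> (real \<times> (real ^ 'n)) set" where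
  "corner_points \<iota> h a p =
     {(h $ \<iota> (k + 1), z) | k z. k \<le> nu \<iota> a p \<and> z \<in> P_set a p \<and> (\<forall>j\<in>{1..k}. z $ \<iota> j = 1)}"

lemma finite_corner_points: "finite (corner_points \<iota> h a p)"
proof (rule finite_subset)
  show "corner_points \<iota> h a p
      \<subseteq> (\<lambda>k. h $ \<iota> (k + 1)) ` {..nu \<iota> a p} \<times> {z. binary_vec z}"
    by (auto simp: corner_points_def P_set_def)
qed (simp add: finite_binary_vec)

lemma mem_coeff_polyhedron_iff:
  fixes \<iota> :: "nat \<Rightarrow> 'n::finite"
  assumes bij: "bij_betw \<iota> {1..CARD('n)} UNIV" and nu: "nu \<iota> a p < CARD('n)"
  shows "(\<alpha>, \<beta>) \<in> coeff_polyhedron \<iota> h a p \<longleftrightarrow>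
    (\<forall>(y, z) \<in> corner_points \<iota> h a p. \<beta> \<le> y + \<alpha> \<bullet> z)"
proof
  assume G: "(\<alpha>, \<beta>) \<in> coeff_polyhedron \<iota> h a p"
  have "\<beta> \<le> h $ \<iota> (k + 1) + \<alpha> \<bullet> z"
    if k: "k \<le> nu \<iota> a p" and z: "z \<in> P_set a p" and ones: "\<forall>j\<in>{1..k}. z $ \<iota> j = 1" for k z
  proof -
    have "k \<le> CARD('n)"
      using k nu by simp
    note split = sum_prefix_ones[OF bij this ones]
    have "z \<in> Pk_set \<iota> a p k"
      using z split[of a] by (simp add: P_set_def Pk_set_def)
    then show ?thesis
      using G k split[of \<alpha>] by (force simp: coeff_polyhedron_def inner_vec_def)
  qed
  then show "\<forall>(y, z) \<in> corner_points \<iota> h a p. \<beta> \<le> y + \<alpha> \<bullet> z"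
    by (auto simp: corner_points_def)
next
  assume V: "\<forall>(y, z) \<in> corner_points \<iota> h a p. \<beta> \<le> y + \<alpha> \<bullet> z"
  have "(\<Sum>j=1..k. \<alpha> $ \<iota> j) + (\<Sum>j=k+1..CARD('n). \<alpha> $ \<iota> j * z $ \<iota> j) + h $ \<iota> (k + 1) \<ge> \<beta>"
    if k: "k \<le> nu \<iota> a p" and z: "z \<in> Pk_set \<iota> a p k" for k z
  proof -
    have "k \<le> CARD('n)"
      using k nu by simp
    note split = sum_fill_prefix[OF bij this]
    have "fill_prefix \<iota> k z \<in> P_set a p"
      using z split[of a z] by (auto simp: P_set_def Pk_set_def binary_vec_def fill_prefix_def)
    moreover have "\<forall>j\<in>{1..k}. fill_prefix \<iota> k z $ \<iota> j = 1"
      by (simp add: fill_prefix_def)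
    ultimately have "(h $ \<iota> (k + 1), fill_prefix \<iota> k z) \<in> corner_points \<iota> h a p"
      using k by (auto simp: corner_points_def)
    then show ?thesis
      using V split[of \<alpha> z] by (auto simp: inner_vec_def)
  qed
  then show "(\<alpha>, \<beta>) \<in> coeff_polyhedron \<iota> h a p"
    by (auto simp: coeff_polyhedron_def)
qed

lemma corner_point_shift_mem_Q_set:
  fixes \<iota> :: "nat \<Rightarrow> 'n::finite"
  assumes bij: "bij_betw \<iota> {1..CARD('n)} UNIV" and nu: "nu \<iota> a p < CARD('n)"
    and decr: "\<forall>i j. 1 \<le> i \<and> i \<le> j \<and> j \<le> CARD('n) \<longrightarrow> h $ \<iota> i \<ge> h $ \<iota> j"
    and h0: "h $ \<iota> (CARD('n)) \<ge> 0"
    and mem: "(y, z) \<in> corner_points \<iota> h a p" and "t \<ge> 0"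
  shows "(y + t, z) \<in> Q_set h a p"
proof -
  obtain k where k: "k \<le> nu \<iota> a p" "y = h $ \<iota> (k + 1)"
    and z: "z \<in> P_set a p" and ones: "\<forall>j\<in>{1..k}. z $ \<iota> j = 1"
    using mem by (auto simp: corner_points_def)
  have y0: "y \<ge> 0"
    using decr[rule_format, of "k + 1" "CARD('n)"] h0 k nu by simp
  have "y + h $ i * z $ i \<ge> h $ i" for i
  proof -
    obtain j where j: "1 \<le> j" "j \<le> CARD('n)" "i = \<iota> j"
      using bij_betw_imp_surj_on[OF bij] UNIV_I[of i] by (metis atLeastAtMost_iff imageE)
    show ?thesis
    proof (cases "j \<le> k")
      case True
      then show ?thesis
        using ones j y0 by simp
    next
      case False
      then have "h $ i \<le> y" "h $ i \<ge> 0"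
        using decr[rule_format, of "k + 1" j] decr[rule_format, of j "CARD('n)"] h0 k j by auto
      moreover have "z $ i \<ge> 0"
        using z by (auto simp: P_set_def binary_vec_def dest: spec[of _ i])
      ultimately show ?thesis
        by (simp add: add_increasing2)
    qed
  qed
  then have "y + t + h $ i * z $ i \<ge> h $ i" for i
    using \<open>t \<ge> 0\<close> by (smt (verit))
  then show ?thesis
    using z y0 \<open>t \<ge> 0\<close> by (simp add: Q_set_def P_set_def)
qed

text \<open>Every binary vector of \<open>P\<close> has a zero entry whose predecessors are all ones.\<close>

lemma first_zero_entry:
  fixes \<iota> :: "nat \<Rightarrow> 'n::finite"
  assumes bij: "bij_betw \<iota> {1..CARD('n)} UNIV"
    and nonneg: "\<forall>j. a $ j \<ge> 0" and big: "(\<Sum>j\<in>UNIV. a $ j) > p"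
    and z: "z \<in> P_set a p"
  obtains k where "k \<le> nu \<iota> a p" and "\<forall>j\<in>{1..k}. z $ \<iota> j = 1" and "z $ \<iota> (k + 1) = 0"
proof -
  have bin: "z $ i = 0 \<or> z $ i = 1" for i
    using z by (auto simp: P_set_def binary_vec_def)
  have weight: "(\<Sum>j\<in>UNIV. a $ j * z $ j) \<le> p"
    using z by (simp add: P_set_def)
  have "\<exists>k. k < CARD('n) \<and> z $ \<iota> (k + 1) = 0"
  proof (rule ccontr)
    assume none: "\<not> ?thesis"
    have "z $ \<iota> j = 1" if "j \<in> {1..CARD('n)}" for j
    proof -
      have "j - 1 < CARD('n)" "j - 1 + 1 = j"
        using that by auto
      then show ?thesis
        using none bin by metis
    qed
    then have "(\<Sum>j\<in>UNIV. a $ j * z $ j) = (\<Sum>j\<in>UNIV. a $ j)"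
      using sum_prefix_ones[OF bij order_refl, of z a]
        sum_UNIV_split_enum[OF bij order_refl, of "($) a"] by simp
    then show False
      using weight big by simp
  qed
  then obtain k where k: "k < CARD('n) \<and> z $ \<iota> (k + 1) = 0"
    and least: "\<And>l. l < k \<Longrightarrow> \<not> (l < CARD('n) \<and> z $ \<iota> (l + 1) = 0)"
    using exists_least_iff[of "\<lambda>k. k < CARD('n) \<and> z $ \<iota> (k + 1) = 0"] by blast
  have ones: "\<forall>j\<in>{1..k}. z $ \<iota> j = 1"
  proof
    fix j assume "j \<in> {1..k}"
    then have "j - 1 < k" "j - 1 < CARD('n)" "j - 1 + 1 = j"
      using k by auto
    then show "z $ \<iota> j = 1"
      using least[of "j - 1"] bin[of "\<iota> j"] by auto
  qed
  have "(\<Sum>j=k+1..CARD('n). a $ \<iota> j * z $ \<iota> j) \<ge> 0"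
    using nonneg bin by (intro sum_nonneg mult_nonneg_nonneg) (auto, metis order_refl zero_le_one)
  then have "(\<Sum>j=1..k. a $ \<iota> j) \<le> p"
    using weight sum_prefix_ones[OF bij _ ones, of a] k by simp
  then have "k \<le> nu \<iota> a p"
    unfolding nu_def using k by (intro Max_ge) auto
  with ones k show thesis
    using that by blast
qed

lemma Q_set_above_corner_point:
  fixes \<iota> :: "nat \<Rightarrow> 'n::finite"
  assumes "bij_betw \<iota> {1..CARD('n)} UNIV"
    and "\<forall>j. a $ j \<ge> 0" and "(\<Sum>j\<in>UNIV. a $ j) > p"
    and Q: "(y, z) \<in> Q_set h a p"
  obtains y' where "(y', z) \<in> corner_points \<iota> h a p" and "y' \<le> y"
proof -
  have z: "z \<in> P_set a p" and y: "\<And>i. y + h $ i * z $ i \<ge> h $ i"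
    using Q by (auto simp: Q_set_def P_set_def)
  obtain k where k: "k \<le> nu \<iota> a p" "\<forall>j\<in>{1..k}. z $ \<iota> j = 1" "z $ \<iota> (k + 1) = 0"
    using first_zero_entry[OF assms(1-3) z] .
  show thesis
  proof (rule that)
    show "(h $ \<iota> (k + 1), z) \<in> corner_points \<iota> h a p"
      using k z by (auto simp: corner_points_def)
    show "h $ \<iota> (k + 1) \<le> y"
      using y[of "\<iota> (k + 1)"] k(3) by simp
  qed
qed

lemma snd_corner_points:
  fixes \<iota> :: "nat \<Rightarrow> 'n::finite"
  assumes "bij_betw \<iota> {1..CARD('n)} UNIV"
    and "\<forall>j. a $ j \<ge> 0" and "(\<Sum>j\<in>UNIV. a $ j) > p"
  shows "snd ` corner_points \<iota> h a p = P_set a p"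
proof
  show "snd ` corner_points \<iota> h a p \<subseteq> P_set a p"
    by (auto simp: corner_points_def)
  show "P_set a p \<subseteq> snd ` corner_points \<iota> h a p"
  proof
    fix z assume z: "z \<in> P_set a p"
    obtain k where "k \<le> nu \<iota> a p" "\<forall>j\<in>{1..k}. z $ \<iota> j = 1"
      using first_zero_entry[OF assms z] .
    then have "(h $ \<iota> (k + 1), z) \<in> corner_points \<iota> h a p"
      using z by (auto simp: corner_points_def)
    then show "z \<in> snd ` corner_points \<iota> h a p"
      by force
  qed
qed

section \<open>Separation by the coefficient polyhedron\<close>

theorem theorem3:
  fixes \<iota> :: "nat \<Rightarrow> 'n::finite"
    and h a zs :: "real ^ 'n"
    and p ys :: real
  assumes "bij_betw \<iota> {1..CARD('n)} UNIV"
    and "\<forall>i j. 1 \<le> i \<and> i \<le> j \<and> j \<le> CARD('n) \<longrightarrow> h $ \<iota> i \<ge> h $ \<iota> j"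
    and "h $ \<iota> (CARD('n)) \<ge> 0"
    and "\<forall>j. a $ j \<ge> 0"
    and "p \<ge> 0"
    and "\<forall>j. a $ j \<le> p"
    and "(\<Sum>j\<in>UNIV. a $ j) > p"
    and "ys \<ge> 0"
    and "\<forall>j. zs $ j \<ge> 0"
    and "zs \<in> convex hull (P_set a p)"
  shows "(\<exists>s. sep_optimal \<iota> h a p zs s) \<and>
    ((ys, zs) \<in> convex hull (Q_set h a p) \<longleftrightarrow> ys + sep_LP \<iota> h a p zs \<ge> 0) \<and>
    (\<forall>\<alpha> \<beta>. ys + sep_LP \<iota> h a p zs < 0 \<and> sep_optimal \<iota> h a p zs (\<alpha>, \<beta>) \<longrightarrow>
       (\<forall>(y, z) \<in> convex hull (Q_set h a p). y + (\<Sum>j\<in>UNIV. \<alpha> $ j * z $ j) \<ge> \<beta>) \<and>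
       ys + (\<Sum>j\<in>UNIV. \<alpha> $ j * zs $ j) < \<beta>)"
proof -
  note bij = assms(1)
  define V where "V = corner_points \<iota> h a p"
  define G where "G = coeff_polyhedron \<iota> h a p"
  have nu: "nu \<iota> a p < CARD('n)"
    using nu_less_card bij assms(5,7) .
  have G_iff: "(\<alpha>, \<beta>) \<in> G \<longleftrightarrow> (\<forall>(y, z)\<in>V. \<beta> \<le> y + \<alpha> \<bullet> z)" for \<alpha> \<beta>
    unfolding G_def V_def by (rule mem_coeff_polyhedron_iff[OF bij nu])
  have obj: "sep_obj zs (\<alpha>, \<beta>) = \<alpha> \<bullet> zs - \<beta>" for \<alpha> \<beta>
    by (simp add: sep_obj_def inner_vec_def)
  have valid: "\<beta> \<le> y + \<alpha> \<bullet> z" if "(\<alpha>, \<beta>) \<in> G" "(y, z) \<in> convex hull Q_set h a p" for \<alpha> \<beta> y z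
  proof (rule convex_hull_valid_inequality[OF _ that(2)])
    fix y z assume "(y, z) \<in> Q_set h a p"
    then obtain y' where "(y', z) \<in> V" "y' \<le> y"
      using Q_set_above_corner_point[OF bij assms(4,7)] unfolding V_def by metis
    then show "\<beta> \<le> y + \<alpha> \<bullet> z"
      using that(1) G_iff by fastforce
  qed

  let ?C = "convex hull V \<inter> {x. snd x = zs}"
  have "finite V"
    unfolding V_def by (rule finite_corner_points)
  then have "compact ?C"
    by (intro compact_Int_closed finite_imp_compact_convex_hull closed_Collect_eq
        continuous_intros)
  moreover have "?C \<noteq> {}"
  proof -
    have "snd ` (convex hull V) = convex hull P_set a p"
      using snd_corner_points[OF bij assms(4,7)]
      by (simp add: V_def convex_hull_linear_image linear_snd)
    then have "zs \<in> snd ` (convex hull V)"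
      using assms(10) by simp
    then show ?thesis
      by blast
  qed
  ultimately obtain x where x: "x \<in> ?C" "\<And>x'. x' \<in> ?C \<Longrightarrow> fst x \<le> fst x'"
    using continuous_attains_inf[of ?C fst] continuous_on_fst[OF continuous_on_id] by blast
  define \<phi> where "\<phi> = fst x"
  have \<phi>: "(\<phi>, zs) \<in> convex hull V" and lowest: "\<And>y. (y, zs) \<in> convex hull V \<Longrightarrow> \<phi> \<le> y"
    using x by (cases x; force simp: \<phi>_def)+

  have weak: "- \<phi> \<le> sep_obj zs s" if "s \<in> G" for s
  proof -
    obtain \<alpha> \<beta> where s: "s = (\<alpha>, \<beta>)"
      by (cases s)
    have "\<beta> \<le> \<phi> + \<alpha> \<bullet> zs"
      by (rule convex_hull_valid_inequality[OF _ \<phi>]) (use that s G_iff in auto)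
    then show ?thesis
      by (simp add: s obj)
  qed
  obtain \<alpha>0 where \<alpha>0: "\<And>y z. (y, z) \<in> V \<Longrightarrow> \<phi> + \<alpha>0 \<bullet> zs \<le> y + \<alpha>0 \<bullet> z"
    using polytope_lower_support[OF \<open>finite V\<close> \<phi> lowest] by metis
  define s0 where "s0 = (\<alpha>0, \<phi> + \<alpha>0 \<bullet> zs)"
  have s0: "s0 \<in> G" "sep_obj zs s0 = - \<phi>"
    using \<alpha>0 by (auto simp: s0_def G_iff obj)
  have optimal_iff: "sep_optimal \<iota> h a p zs s \<longleftrightarrow> s \<in> G \<and> sep_obj zs s = - \<phi>" for s
    using s0 weak unfolding sep_optimal_def is_arg_min_linorder G_def[symmetric]
    by (metis order_antisym)
  have LP: "sep_LP \<iota> h a p zs = - \<phi>"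
    unfolding sep_LP_def G_def[symmetric]
    by (rule Least_equality) (use s0 weak in force)+

  have "(ys, zs) \<in> convex hull Q_set h a p \<longleftrightarrow> ys \<ge> \<phi>"
  proof
    assume "(ys, zs) \<in> convex hull Q_set h a p"
    then show "ys \<ge> \<phi>"
      using valid[of \<alpha>0 "\<phi> + \<alpha>0 \<bullet> zs" ys zs] s0(1) by (simp add: s0_def)
  next
    assume "ys \<ge> \<phi>"
    then show "(ys, zs) \<in> convex hull Q_set h a p"
      using convex_hull_shift_up[OF \<phi>] corner_point_shift_mem_Q_set[OF bij nu assms(2,3)]
      unfolding V_def by blast
  qed
  moreover have "(\<forall>(y, z) \<in> convex hull Q_set h a p. y + (\<Sum>j\<in>UNIV. \<alpha> $ j * z $ j) \<ge> \<beta>) \<and>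
      ys + (\<Sum>j\<in>UNIV. \<alpha> $ j * zs $ j) < \<beta>"
    if "ys + sep_LP \<iota> h a p zs < 0" "sep_optimal \<iota> h a p zs (\<alpha>, \<beta>)" for \<alpha> \<beta>
    using that valid[of \<alpha> \<beta>] by (auto simp: optimal_iff LP obj inner_vec_def)
  moreover have "sep_optimal \<iota> h a p zs s0"
    using s0 optimal_iff by simp
  moreover have "ys + sep_LP \<iota> h a p zs \<ge> 0 \<longleftrightarrow> ys \<ge> \<phi>"
    by (simp add: LP)
  ultimately show ?thesis
    by blast
qed

end
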